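(* Let $-1\le B<A\le1$, let $g\in\Sigma^*(A,B)$, and let $G$ be its inverse function, valid in some neighborhood of infinity, with representation $G(w)=w\left(1+\sum_{n=1}^{\infty}B_nw^{-n}\right)$. Put $\delta=(1-A)/(1-B)$, and for a fixed $n\in\mathbb{N}$ put $\mathbb{I}_k(n)=\left[\frac kn,\frac{k+1}n\right)$, $k=0,1,\ldots,n-1$. Then: (i) for all $-1\le B<A\le1$, $$|B_1|\le A-B\quad\text{and}\quad|B_2|\le\frac{A-B}{2}; \tag{a}$$ (ii) if $n\ge2$ and $\delta\in\mathbb{I}_k(n)$ for some $k\in\{0,1,\ldots,n-2\}$, then $$|B_{n+1}|\le\frac{n-k}{n(n+1)}\prod_{j=0}^{n-k-1}\frac{n(A-B)+Bj}{j+1};$$ (iii) if $n\ge2$ and $\delta\in\mathbb{I}_{n-1}(n)$, then $$|B_{n+1}|\le\frac{A-B}{n+1}. \tag{b}$$ The estimates in (a) and (b) are sharp.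
   Context: $\Sigma$ denotes the class of meromorphic univalent functions $g$ in $\Delta=\{z\in\mathbb{C}\cup\{\infty\}:|z|>1\}$ of the form $g(z)=z\left(1+\sum_{n=1}^\infty b_nz^{-n}\right)$ for $1<|z|<\infty$. For $-1\le B<A\le1$, $\Sigma^*(A,B)$ is the class of $g\in\Sigma$ satisfying $$\frac1z\,\frac{g'(1/z)}{g(1/z)}\prec\frac{1+Az}{1+Bz}\quad\text{for }z\in\mathbb{D}=\{|z|<1\},$$ where $\prec$ denotes subordination of analytic functions in $\mathbb{D}$ (the left-hand side is extended analytically to $z=0$ with value $1$). In the representation of $G$, $B_n$ ($n\ge1$) denote coefficients, not to be confused with the parameter $B$. An estimate is called sharp if, for each admissible choice of the parameters and of the index, equality is attained by some function in $\Sigma^*(A,B)$. *)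

theory Defs
  imports "HOL-Complex_Analysis.Complex_Analysis"
begin

text \<open>The finite part of the exterior disc \<open>\<Delta>\<close>; the point at infinity is treated via
  expansions in powers of \<open>1/z\<close>.\<close>

definition exterior :: "complex set" where
  "exterior = {z. 1 < norm z}"

definition expands_at :: "(complex \<Rightarrow> complex) \<Rightarrow> (nat \<Rightarrow> complex) \<Rightarrow> complex \<Rightarrow> bool" where
  "expands_at f c z \<longleftrightarrow>
     summable (\<lambda>n. c (Suc n) / z ^ Suc n) \<and>
     f z = z * (1 + (\<Sum>n. c (Suc n) / z ^ Suc n))"

text \<open>A member of \<open>\<Sigma>\<close> has a pole at infinity, by the expansion.  As a univalent map
  into the Riemann sphere it takes the value \<open>\<infinity>\<close> nowhere else, so it is holomorphic on
  the finite part of \<open>\<Delta>\<close>, and univalence in \<open>\<Delta>\<close> is injectivity on that finite part.\<close>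

definition Sigma_class :: "(complex \<Rightarrow> complex) set" where
  "Sigma_class = {g. g holomorphic_on exterior \<and> inj_on g exterior \<and>
     (\<exists>b. \<forall>z\<in>exterior. expands_at g b z)}"

definition subordinate :: "(complex \<Rightarrow> complex) \<Rightarrow> (complex \<Rightarrow> complex) \<Rightarrow> bool" where
  "subordinate f F \<longleftrightarrow>
     f holomorphic_on ball 0 1 \<and> F holomorphic_on ball 0 1 \<and>
     (\<exists>\<omega>. \<omega> holomorphic_on ball 0 1 \<and> \<omega> 0 = 0 \<and>
        (\<forall>z\<in>ball 0 1. \<omega> z \<in> ball 0 1 \<and> f z = F (\<omega> z)))"

text \<open>The convention \<open>x / 0 = 0\<close> does no harm here: \<open>g' / g\<close> is unbounded near a zero of \<open>g\<close>,
  so if \<open>g\<close> vanished somewhere in \<open>exterior\<close>, the function below would not be holomorphic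
  on the unit disc.\<close>

definition star_quotient :: "(complex \<Rightarrow> complex) \<Rightarrow> complex \<Rightarrow> complex" where
  "star_quotient g z = (if z = 0 then 1 else (1 / z) * (deriv g (1 / z) / g (1 / z)))"

definition Sigma_star :: "real \<Rightarrow> real \<Rightarrow> (complex \<Rightarrow> complex) set" where
  "Sigma_star A B = {g \<in> Sigma_class.
     subordinate (star_quotient g)
       (\<lambda>z. (1 + complex_of_real A * z) / (1 + complex_of_real B * z))}"

text \<open>\<open>G\<close> is the inverse of \<open>g\<close> in some neighbourhood of infinity, with
  \<open>G w = w (1 + (\<Sum>n\<ge>1. c n / w ^ n))\<close> there; the value \<open>c 0\<close> is irrelevant.  For injective
  \<open>g\<close> with a pole at infinity, a right inverse near infinity with values in \<open>exterior\<close>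
  is also a left inverse there.\<close>

definition inverse_near_infinity ::
    "(complex \<Rightarrow> complex) \<Rightarrow> (complex \<Rightarrow> complex) \<Rightarrow> (nat \<Rightarrow> complex) \<Rightarrow> bool" where
  "inverse_near_infinity g G c \<longleftrightarrow>
     (\<forall>\<^sub>F w in at_infinity. G w \<in> exterior \<and> g (G w) = w \<and> expands_at G c w)"

definition delta :: "real \<Rightarrow> real \<Rightarrow> real" where
  "delta A B = (1 - A) / (1 - B)"

definition I_interval :: "nat \<Rightarrow> nat \<Rightarrow> real set" where
  "I_interval n k = {real k / real n ..< (real k + 1) / real n}"

end

theory Submission
  imports Defs
begin

text \<open>
  Put \<open>h z = z * g (1 / z)\<close>, which is holomorphic in the unit disc with \<open>h 0 = 1\<close>.  Two facts
  carry the theorem.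

  First, Lagrange inversion (\<open>inverse_coefficients\<close>): the coefficient \<open>c (n + 1)\<close> of the inverse
  is, up to the factor \<open>- 1 / n\<close>, the coefficient of \<open>z ^ (n + 1)\<close> in \<open>P = h ^ n\<close>.  This reduces
  inverse coefficients of \<open>g\<close> to ordinary coefficients of a power of \<open>h\<close>.

  Second, Clunie's method.  The subordination says \<open>z * h' / h = - (A - B) * \<omega> / (1 + B * \<omega>)\<close>
  with a Schwarz function \<open>\<omega>\<close>, so \<open>z * P' = - \<omega> * (a * P + B * z * P')\<close> with
  \<open>a = n * (A - B)\<close>.  Multiplication by \<open>\<omega>\<close> does not increase the sum of the squared moduli of
  the coefficients of a polynomial (\<open>bounded_imp_contractive\<close>), and \<open>\<omega> 0 = 0\<close> lets the equation
  be truncated; hence (\<open>clunie_energy\<close>)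
  \<open>(\<Sum>m\<le>M. m\<^sup>2 * \<bar>P m\<bar>\<^sup>2) \<le> (\<Sum>m<M. (a + B * m)\<^sup>2 * \<bar>P m\<bar>\<^sup>2)\<close>, writing \<open>P m\<close> for the coefficients.
  The weight \<open>(a + B * m)\<^sup>2 - m\<^sup>2\<close> is nonnegative for
  \<open>m \<le> a / (1 - B) = n * (1 - \<delta>)\<close> and nonpositive afterwards.  As long as it is nonnegative,
  induction bounds \<open>\<bar>P m\<bar>\<close> by the product \<open>Q m = (\<Prod>j<m. (a + B * j) / (j + 1))\<close>, for which the
  inequality telescopes to an equality; later terms may be dropped.  If
  \<open>\<delta>\<close> lies in the \<open>k\<close>-th interval, the sign changes after \<open>L = n - k\<close> terms, and
  \<open>(n + 1) * \<bar>P (n + 1)\<bar> \<le> L * Q L\<close> results (\<open>energy_majorant\<close>).  Division by \<open>n * (n + 1)\<close> is the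
  stated bound: \<open>k = n - 1\<close> turns it into \<open>(A - B) / (n + 1)\<close>, and \<open>n = 1\<close>, \<open>k = 0\<close> into the
  bound on \<open>c 2\<close>.

  For sharpness take \<open>\<omega> z = z ^ m\<close>.  Then the \<open>m\<close>-th coefficient of \<open>h ^ n\<close> is
  \<open>- n * (A - B) / m\<close>, which gives \<open>\<bar>c m\<bar> = (A - B) / m\<close> for every \<open>m \<ge> 1\<close>.  That this \<open>g\<close> is
  univalent follows from starlikeness: a logarithm of \<open>1 / g\<close>, as a function of
  \<open>s = - ln z\<close> in a half-plane, has a derivative with positive real part.
\<close>

section \<open>Lagrange inversion at infinity\<close>

lemma fps_compose_mult_nth:
  fixes K f Y :: "'a::comm_ring_1 fps"
  assumes "fps_nth f 0 = 0"
  shows "fps_nth ((K oo f) * Y) N = (\<Sum>i\<le>N. fps_nth K i * fps_nth (f ^ i * Y) N)"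
proof -
  have "fps_nth ((K oo f) * Y) N = (\<Sum>l\<le>N. \<Sum>i\<le>l. fps_nth K i * fps_nth (f ^ i) l * fps_nth Y (N - l))"
    by (simp add: fps_mult_nth fps_compose_nth sum_distrib_right atLeast0AtMost)
  also have "\<dots> = (\<Sum>l\<le>N. \<Sum>i\<le>N. fps_nth K i * fps_nth (f ^ i) l * fps_nth Y (N - l))"
  proof (rule sum.cong[OF refl])
    fix l assume "l \<in> {..N}"
    then show "(\<Sum>i\<le>l. fps_nth K i * fps_nth (f ^ i) l * fps_nth Y (N - l)) =
        (\<Sum>i\<le>N. fps_nth K i * fps_nth (f ^ i) l * fps_nth Y (N - l))"
      using startsby_zero_power_prefix[OF assms] by (intro sum.mono_neutral_left) auto
  qed
  also have "\<dots> = (\<Sum>i\<le>N. \<Sum>l\<le>N. fps_nth K i * fps_nth (f ^ i) l * fps_nth Y (N - l))"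
    by (rule sum.swap)
  also have "\<dots> = (\<Sum>i\<le>N. fps_nth K i * fps_nth (f ^ i * Y) N)"
    by (simp add: fps_mult_nth sum_distrib_left atLeast0AtMost mult.assoc)
  finally show ?thesis .
qed

lemma fps_nth_X_mult_deriv:
  fixes P :: "'a::comm_semiring_1 fps"
  shows "fps_nth (fps_X * fps_deriv P) m = of_nat m * fps_nth P m"
  by (cases m) auto

text \<open>Put \<open>f = X / H\<close> and \<open>u = 1 / H\<close>.  The hypothesis writes \<open>u\<close> as the sum of \<open>K\<^sub>j * f ^ j\<close>.
  Multiply the derivative of this sum by \<open>f ^ - (n + 1)\<close> and take residues: a power of \<open>f\<close> times
  \<open>f'\<close> has residue zero, except for \<open>f' / f\<close> with residue \<open>1\<close>, so \<open>(n + 1) * K (n + 1)\<close> remains.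
  On the other side stands \<open>u' * u ^ - (n + 1) * X ^ - (n + 1)\<close>, where the first two factors are
  the derivative of \<open>- H ^ n / n\<close>.  The proof clears all negative powers with powers of \<open>H\<close>, to
  stay within power series.  For \<open>n = 0\<close> the second equation is \<open>0 = 0\<close>, hence the separate
  statement about the first coefficient.\<close>

lemma lagrange_inversion_at_infinity:
  fixes H K :: "'a::field_char_0 fps"
  assumes H0: "fps_nth H 0 = 1" and comp: "K oo (fps_X * inverse H) = inverse H"
  shows "fps_nth K 1 = - fps_nth H 1"
    and "of_nat n * fps_nth K (Suc n) = - fps_nth (H ^ n) (Suc n)"
proof -
  define u where "u = inverse H"
  define f where "f = fps_X * u"
  have f0: "fps_nth f 0 = 0" by (simp add: f_def)
  have uH: "u * H = 1" using H0 by (simp add: u_def inverse_mult_eq_1)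
  have "fps_nth u 1 = - fps_nth H 1"
    using arg_cong[OF uH, of "\<lambda>s. fps_nth s 1"] H0
    by (simp add: fps_mult_nth u_def eq_neg_iff_add_eq_0 add.commute)
  moreover have "fps_nth (K oo f) 1 = fps_nth K 1"
    using H0 by (simp add: fps_compose_nth f_def u_def)
  ultimately show "fps_nth K 1 = - fps_nth H 1"
    using comp by (simp add: u_def f_def)
  \<comment> \<open>The Euler operator multiplies the \<open>m\<close>-th coefficient by \<open>m\<close>; the claim compares the
    coefficients of \<open>th u * H ^ (n + 1)\<close>, evaluated once directly and once through
    \<open>u = K oo f\<close>.\<close>
  define th where "th = (\<lambda>s::'a fps. fps_X * fps_deriv s)"
  have th_mult: "th (a * b) = th a * b + a * th b" for a b
    by (simp add: th_def algebra_simps)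
  have th_nth: "fps_nth (th s) m = of_nat m * fps_nth s m" for s m
    unfolding th_def by (rule fps_nth_X_mult_deriv)
  have th_power: "th (H ^ Suc k) = of_nat (Suc k) * (H ^ k * th H)" for k
    by (simp only: th_def fps_deriv_power diff_Suc_1 fps_of_nat mult_ac)
  have thu: "th u * H = - (u * th H)"
  proof -
    have "th (u * H) = 0" by (simp add: uH th_def)
    then show ?thesis by (simp add: th_mult eq_neg_iff_add_eq_0)
  qed
  have thf: "th f * H = fps_X * (1 - u * th H)"
  proof -
    have "th f * H = fps_X * (u * H + th u * H)"
      by (simp add: f_def th_def algebra_simps)
    then show ?thesis by (simp add: uH thu)
  qed
  have fH: "f ^ i * H ^ i = fps_X ^ i" for i
    by (simp add: f_def power_mult_distrib[symmetric] mult.assoc uH)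
  \<comment> \<open>This is the vanishing of the residue of \<open>f ^ i * f'\<close> for \<open>i \<noteq> -1\<close>, after clearing the
    negative powers of \<open>f = X / H\<close> with powers of \<open>H\<close>.\<close>
  have summand: "fps_nth (f ^ i * (th f * H ^ Suc n)) (Suc n) = (if i = n then 1 else 0)" if "i \<le> n" for i
  proof -
    have "f ^ i * (th f * H ^ Suc n) = (f ^ i * H ^ i) * H ^ (n - i) * (th f * H)"
      using that by (simp add: power_add[symmetric] algebra_simps)
    also have "\<dots> = fps_X ^ Suc i * (H ^ (n - i) * (1 - u * th H))"
      unfolding fH thf by (simp add: mult_ac)
    finally have eq: "fps_nth (f ^ i * (th f * H ^ Suc n)) (Suc n) =
        fps_nth (H ^ (n - i) * (1 - u * th H)) (n - i)"
      using that by (simp only: fps_X_power_mult_nth) simp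
    show ?thesis
    proof (cases "i = n")
      case True
      have "fps_nth (H ^ (n - i) * (1 - u * th H)) (n - i) = 1" unfolding True by (simp add: th_def)
      then show ?thesis unfolding eq using True by simp
    next
      case False
      with that have "n - i \<noteq> 0" by auto
      then obtain k where k: "n - i = Suc k" using not0_implies_Suc by blast
      have "H ^ Suc k * (1 - u * th H) = H ^ Suc k - H ^ k * th H * (u * H)"
        by (simp add: algebra_simps)
      also have "\<dots> = H ^ Suc k - H ^ k * th H" unfolding uH by simp
      finally have "of_nat (Suc k) * (H ^ Suc k * (1 - u * th H)) = of_nat (Suc k) * H ^ Suc k - th (H ^ Suc k)"
        unfolding th_power by (simp only: right_diff_distrib)
      then have "fps_nth (of_nat (Suc k) * (H ^ Suc k * (1 - u * th H))) (Suc k) = 0"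
        by (simp only: fps_sub_nth th_nth fps_mult_of_nat_nth) simp
      then have "of_nat (Suc k) * fps_nth (H ^ Suc k * (1 - u * th H)) (Suc k) = 0"
        by (simp only: fps_mult_of_nat_nth)
      then have "fps_nth (H ^ Suc k * (1 - u * th H)) (Suc k) = 0"
        using of_nat_neq_0 mult_eq_0_iff by blast
      then show ?thesis unfolding eq k using False by simp
    qed
  qed
  have "th u = (fps_deriv K oo f) * th f"
    using arg_cong[OF comp, of th] f0
    by (simp add: th_def u_def f_def fps_compose_deriv algebra_simps)
  then have "fps_nth (th u * H ^ Suc n) (Suc n) =
      fps_nth ((fps_deriv K oo f) * (th f * H ^ Suc n)) (Suc n)"
    by (simp add: mult.assoc)
  also have "\<dots> = (\<Sum>i\<le>n. fps_nth (fps_deriv K) i * (if i = n then 1 else 0))"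
  proof -
    have "fps_nth (f ^ Suc n * (th f * H ^ Suc n)) (Suc n) = 0"
    proof -
      have "f ^ Suc n * (th f * H ^ Suc n) = (f ^ Suc n * H ^ Suc n) * th f"
        by (simp only: mult_ac)
      also have "\<dots> = fps_X ^ Suc n * th f" by (simp only: fH)
      finally show ?thesis by (simp only: fps_X_power_mult_nth) (simp add: th_def)
    qed
    then show ?thesis
      unfolding fps_compose_mult_nth[OF f0] sum.atMost_Suc using summand by simp
  qed
  also have "\<dots> = of_nat (Suc n) * fps_nth K (Suc n)" by (simp add: if_distrib cong: if_cong)
  finally have main: "fps_nth (th u * H ^ Suc n) (Suc n) = of_nat (Suc n) * fps_nth K (Suc n)" .
  show "of_nat n * fps_nth K (Suc n) = - fps_nth (H ^ n) (Suc n)"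
  proof (cases n)
    case 0
    then show ?thesis by simp
  next
    case (Suc k)
    have "th u * H ^ Suc n = (th u * H) * H * H ^ k" using Suc by (simp add: algebra_simps)
    also have "\<dots> = - (H ^ k * th H * (u * H))" unfolding thu by (simp add: algebra_simps)
    finally have "of_nat n * (th u * H ^ Suc n) = - th (H ^ n)"
      using th_power[of k] uH Suc by simp
    then have "fps_nth (of_nat n * (th u * H ^ Suc n)) (Suc n) = - (of_nat (Suc n) * fps_nth (H ^ n) (Suc n))"
      by (simp only: fps_neg_nth th_nth)
    then have "of_nat n * (of_nat (Suc n) * fps_nth K (Suc n)) = - (of_nat (Suc n) * fps_nth (H ^ n) (Suc n))"
      by (simp only: fps_mult_of_nat_nth main)
    then have "of_nat (Suc n) * (of_nat n * fps_nth K (Suc n)) = of_nat (Suc n) * (- fps_nth (H ^ n) (Suc n))"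
      by (simp only: mult_ac mult_minus_right)
    then show ?thesis using of_nat_neq_0 mult_left_cancel by blast
  qed
qed

section \<open>Multiplication by a bounded function\<close>

text \<open>Multiplication by \<open>W\<close> is a contraction of the Hardy space \<open>H\<^sup>2\<close>, tested on polynomials only
  and expressed through finitely many coefficients, so that no convergence is involved.\<close>

definition contractive :: "complex fps \<Rightarrow> bool" where
  "contractive W \<longleftrightarrow> (\<forall>S M N. (\<Sum>m\<le>N. (norm (fps_nth (W * fps_cutoff M S) m))\<^sup>2) \<le> (\<Sum>m<M. (norm (fps_nth S m))\<^sup>2))"

lemma sum_cis_orthogonal:
  assumes "0 < N" and "m < N" "l < N"
  shows "(\<Sum>k<N. cis (2 * pi * real k / real N) ^ m * cnj (cis (2 * pi * real k / real N)) ^ l)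
     = (if m = l then of_nat N else 0)"
proof -
  define \<zeta> where "\<zeta> = cis (2 * pi * (real m - real l) / real N)"
  have "cis (2 * pi * real k / real N) ^ m * cnj (cis (2 * pi * real k / real N)) ^ l = \<zeta> ^ k" for k
    by (simp add: cis_cnj Complex.DeMoivre cis_mult \<zeta>_def algebra_simps diff_divide_distrib)
  then have sum: "(\<Sum>k<N. cis (2 * pi * real k / real N) ^ m * cnj (cis (2 * pi * real k / real N)) ^ l) = (\<Sum>k<N. \<zeta> ^ k)"
    by simp
  show ?thesis
  proof (cases "m = l")
    case True then show ?thesis using sum by (simp add: \<zeta>_def)
  next
    case False
    have "\<zeta> ^ N = cis (2 * pi * of_int (int m - int l))"
      using assms(1) by (simp add: \<zeta>_def Complex.DeMoivre)
    then have pow: "\<zeta> ^ N = 1" by (simp only: cis_multiple_2pi Ints_of_int)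
    have "\<zeta> \<noteq> 1"
    proof
      assume "\<zeta> = 1"
      then have "cos (2 * pi * (real m - real l) / real N) = 1" by (simp add: \<zeta>_def complex_eq_iff)
      then obtain i :: int where "2 * pi * (real m - real l) / real N = of_int i * 2 * pi"
        using cos_one_2pi_int by blast
      then have "(2 * pi) * (real m - real l) = (2 * pi) * (of_int i * real N)"
        using assms(1) by (simp add: field_simps)
      then have "real m - real l = of_int i * real N" by (subst (asm) mult_left_cancel) auto
      then have i: "int m - int l = i * int N"
        by (metis of_int_diff of_int_eq_iff of_int_mult of_int_of_nat_eq)
      then have "int N dvd int m - int l" by simp
      then have "int N \<le> \<bar>int m - int l\<bar>" using False by (intro dvd_imp_le_int[of _ "int N", simplified]) auto
      then show False using assms by linarith
    qed
    then show ?thesis using sum pow False by (simp add: sum_gp_strict)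
  qed
qed

lemma discrete_parseval:
  fixes a :: "nat \<Rightarrow> complex" and r :: real
  assumes "0 < N"
  shows "(\<Sum>k<N. (norm (\<Sum>m<N. a m * (of_real r * cis (2 * pi * real k / real N)) ^ m))\<^sup>2)
     = real N * (\<Sum>m<N. (norm (a m))\<^sup>2 * r ^ (2 * m))"
proof -
  define e where "e = (\<lambda>k. cis (2 * pi * real k / real N))"
  define b where "b = (\<lambda>m. a m * of_real r ^ m)"
  have "complex_of_real (\<Sum>k<N. (norm (\<Sum>m<N. a m * (of_real r * e k) ^ m))\<^sup>2)
      = (\<Sum>k<N. (\<Sum>m<N. b m * e k ^ m) * cnj (\<Sum>l<N. b l * e k ^ l))"
    by (simp only: of_real_sum complex_norm_square b_def power_mult_distrib mult.assoc)
  also have "\<dots> = (\<Sum>k<N. \<Sum>m<N. \<Sum>l<N. b m * cnj (b l) * (e k ^ m * cnj (e k) ^ l))"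
    by (simp add: sum_product mult_ac)
  also have "\<dots> = (\<Sum>m<N. \<Sum>k<N. \<Sum>l<N. b m * cnj (b l) * (e k ^ m * cnj (e k) ^ l))"
    by (rule sum.swap)
  also have "\<dots> = (\<Sum>m<N. \<Sum>l<N. \<Sum>k<N. b m * cnj (b l) * (e k ^ m * cnj (e k) ^ l))"
    by (intro sum.cong refl sum.swap)
  also have "\<dots> = (\<Sum>m<N. \<Sum>l<N. if m = l then b m * cnj (b l) * of_nat N else 0)"
    unfolding sum_distrib_left[symmetric] e_def
    by (intro sum.cong refl) (simp add: sum_cis_orthogonal[OF assms])
  also have "\<dots> = (\<Sum>m<N. b m * cnj (b m) * of_nat N)" by simp
  also have "\<dots> = complex_of_real (real N * (\<Sum>m<N. (norm (a m))\<^sup>2 * r ^ (2 * m)))"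
  proof -
    have "b m * cnj (b m) = of_real ((norm (a m))\<^sup>2 * r ^ (2 * m))" for m
      by (simp add: b_def complex_norm_square power_mult_distrib power_add mult_2 mult_ac del: of_real_power)
         (simp add: power_mult power2_eq_square)
    then show ?thesis by (simp add: sum_distrib_left mult_ac)
  qed
  finally show ?thesis unfolding e_def of_real_eq_iff .
qed

text \<open>By Parseval the squared coefficients of \<open>\<omega> * s\<close> are a mean of \<open>\<bar>\<omega> * s\<bar>\<^sup>2 \<le> \<bar>s\<bar>\<^sup>2\<close> over a circle.
  The mean is taken over roots of unity, which is exact for polynomials; this replaces
  integration by finite sums and a uniform approximation.\<close>

lemma bounded_imp_contractive:
  assumes hol: "\<omega> holomorphic_on ball 0 1" and bd: "\<And>z. z \<in> ball 0 1 \<Longrightarrow> norm (\<omega> z) \<le> 1"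
    and W: "\<omega> has_fps_expansion W"
  shows "contractive W"
  unfolding contractive_def
proof (intro allI)
  fix S :: "complex fps" and M N0 :: nat
  define s where "s = (\<lambda>z. \<Sum>m<M. fps_nth S m * z ^ m)"
  define a where "a = fps_nth (W * fps_cutoff M S)"
  define E where "E = (\<Sum>m<M. (norm (fps_nth S m))\<^sup>2)"
  have s_exp: "s has_fps_expansion fps_cutoff M S"
  proof -
    have "s has_fps_expansion (\<Sum>m<M. fps_const (fps_nth S m) * fps_X ^ m)"
      unfolding s_def by (intro fps_expansion_intros)
    also have "(\<Sum>m<M. fps_const (fps_nth S m) * fps_X ^ m) = fps_cutoff M S"
      by (rule fps_ext) (auto simp: fps_sum_nth if_distrib cong: if_cong)
    finally show ?thesis .
  qed
  have Fexp: "(\<lambda>z. \<omega> z * s z) has_fps_expansion W * fps_cutoff M S"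
    by (intro fps_expansion_intros W s_exp)
  have Fhol: "(\<lambda>z. \<omega> z * s z) holomorphic_on eball 0 1"
    using hol unfolding s_def by (auto simp: one_ereal_def intro!: holomorphic_intros)
  have rad: "fps_conv_radius (W * fps_cutoff M S) \<ge> 1"
    by (rule holomorphic_on_imp_fps_conv_radius_ge[OF Fexp Fhol])
  \<comment> \<open>On the circle of radius \<open>1 - \<epsilon>\<close> a long partial sum of \<open>\<omega> * s\<close> is \<open>\<epsilon>\<close>-close to
    \<open>\<omega> * s\<close>, so the discrete Parseval identity applies to a polynomial.\<close>
  have approx: "(\<Sum>m\<le>N0. (norm (a m))\<^sup>2 * (1 - \<epsilon>) ^ (2 * m)) \<le> (1 + \<epsilon>) * E + \<epsilon> + \<epsilon>\<^sup>2"
    if \<epsilon>: "0 < \<epsilon>" "\<epsilon> < 1" for \<epsilon> :: real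
  proof -
    define r where "r = 1 - \<epsilon>"
    have r: "0 < r" "r < 1" using \<epsilon> by (auto simp: r_def)
    have sm: "summable (\<lambda>m. norm (a m * of_real r ^ m))"
      unfolding a_def
    proof (rule norm_summable_fps)
      have "ereal (norm (complex_of_real r)) < 1" using r by simp
      then show "ereal (norm (complex_of_real r)) < fps_conv_radius (W * fps_cutoff M S)"
        using rad by (rule less_le_trans)
    qed
    then obtain N1 where N1: "\<And>N. N \<ge> N1 \<Longrightarrow> norm (\<Sum>m. norm (a (m + N) * of_real r ^ (m + N))) < \<epsilon>"
      using suminf_exist_split[OF \<epsilon>(1) sm] by blast
    define N where "N = max N1 (max (Suc N0) M)"
    have N: "N \<ge> N1" "N0 < N" "M \<le> N" "0 < N" by (auto simp: N_def)
    have tail: "norm (\<Sum>m<N. a m * z ^ m) \<le> norm (s z) + \<epsilon>" if z: "norm z = r" for z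
    proof -
      have zb: "z \<in> ball 0 1" using z r by simp
      have sz: "summable (\<lambda>m. norm (a m * z ^ m))"
        using sm z r by (simp add: norm_mult norm_power)
      have Feq: "(\<Sum>m. a m * z ^ m) = \<omega> z * s z"
      proof -
        have "eval_fps (W * fps_cutoff M S) z = \<omega> z * s z"
          by (rule has_fps_expansion_imp_eval_fps_eq[OF Fexp, of _ 1]) (use hol Fhol zb in \<open>auto simp: one_ereal_def\<close>)
        then show ?thesis by (simp add: eval_fps_def a_def)
      qed
      have "(\<Sum>m<N. a m * z ^ m) = \<omega> z * s z - (\<Sum>m. a (m + N) * z ^ (m + N))"
        using suminf_split_initial_segment[OF summable_norm_cancel[OF sz], of N] Feq by simp
      then have "norm (\<Sum>m<N. a m * z ^ m) \<le> norm (\<omega> z * s z) + norm (\<Sum>m. a (m + N) * z ^ (m + N))"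
        by (metis norm_triangle_ineq4)
      also have "norm (\<Sum>m. a (m + N) * z ^ (m + N)) \<le> (\<Sum>m. norm (a (m + N) * z ^ (m + N)))"
        by (rule summable_norm) (use sz summable_iff_shift[of "\<lambda>m. norm (a m * z ^ m)" N] in simp)
      also have "\<dots> = (\<Sum>m. norm (a (m + N) * of_real r ^ (m + N)))"
        using z r by (simp add: norm_mult norm_power)
      also have "\<dots> \<le> \<epsilon>" using N1[OF N(1)] by simp
      also have "norm (\<omega> z * s z) \<le> norm (s z)"
        using bd[OF zb] by (simp add: norm_mult mult_left_le_one_le)
      finally show ?thesis by simp
    qed
    have sq: "(norm (\<Sum>m<N. a m * z ^ m))\<^sup>2 \<le> (1 + \<epsilon>) * (norm (s z))\<^sup>2 + (\<epsilon> + \<epsilon>\<^sup>2)" if z: "norm z = r" for z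
    proof -
      have "(norm (\<Sum>m<N. a m * z ^ m))\<^sup>2 \<le> (norm (s z) + \<epsilon>)\<^sup>2"
        using tail[OF z] by (intro power_mono) auto
      \<comment> \<open>The cross term is absorbed by \<open>2 \<epsilon> t \<le> \<epsilon> (t\<^sup>2 + 1)\<close>, which keeps the bound
        linear in \<open>norm (s z)\<^sup>2\<close>, so that Parseval can be applied to \<open>s\<close> as well.\<close>
      moreover have "0 \<le> \<epsilon> * (norm (s z) - 1)\<^sup>2" using \<epsilon> by simp
      ultimately show ?thesis by (simp add: power2_eq_square algebra_simps)
    qed
    define z where "z = (\<lambda>k. of_real r * cis (2 * pi * real k / real N))"
    have nz: "norm (z k) = r" for k using r by (simp add: z_def norm_mult)
    define s' where "s' = (\<lambda>m. if m < M then fps_nth S m else 0)"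
    have s': "s w = (\<Sum>m<N. s' m * w ^ m)" for w
      unfolding s_def s'_def using N(3) by (intro sum.mono_neutral_cong_left) auto
    have "real N * (\<Sum>m<N. (norm (a m))\<^sup>2 * r ^ (2 * m)) = (\<Sum>k<N. (norm (\<Sum>m<N. a m * z k ^ m))\<^sup>2)"
      unfolding z_def by (rule discrete_parseval[OF N(4), symmetric])
    also have "\<dots> \<le> (\<Sum>k<N. (1 + \<epsilon>) * (norm (s (z k)))\<^sup>2 + (\<epsilon> + \<epsilon>\<^sup>2))"
      by (intro sum_mono sq nz)
    also have "\<dots> = (1 + \<epsilon>) * (\<Sum>k<N. (norm (\<Sum>m<N. s' m * z k ^ m))\<^sup>2) + real N * (\<epsilon> + \<epsilon>\<^sup>2)"
      by (simp add: sum.distrib sum_distrib_left s')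
    also have "(\<Sum>k<N. (norm (\<Sum>m<N. s' m * z k ^ m))\<^sup>2) = real N * (\<Sum>m<N. (norm (s' m))\<^sup>2 * r ^ (2 * m))"
      unfolding z_def by (rule discrete_parseval[OF N(4)])
    finally have "real N * (\<Sum>m<N. (norm (a m))\<^sup>2 * r ^ (2 * m)) \<le>
        real N * ((1 + \<epsilon>) * (\<Sum>m<N. (norm (s' m))\<^sup>2 * r ^ (2 * m)) + (\<epsilon> + \<epsilon>\<^sup>2))"
      by (simp only: distrib_left mult_ac)
    then have "(\<Sum>m<N. (norm (a m))\<^sup>2 * r ^ (2 * m)) \<le> (1 + \<epsilon>) * (\<Sum>m<N. (norm (s' m))\<^sup>2 * r ^ (2 * m)) + (\<epsilon> + \<epsilon>\<^sup>2)"
      using N(4) by simp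
    moreover have "(\<Sum>m<N. (norm (s' m))\<^sup>2 * r ^ (2 * m)) \<le> E"
    proof -
      have "(\<Sum>m<N. (norm (s' m))\<^sup>2 * r ^ (2 * m)) \<le> (\<Sum>m<N. (norm (s' m))\<^sup>2)"
        using r by (intro sum_mono) (simp add: mult_left_le power_le_one)
      also have "\<dots> = E"
        unfolding E_def s'_def using N(3) by (intro sum.mono_neutral_cong_right) auto
      finally show ?thesis .
    qed
    then have "(1 + \<epsilon>) * (\<Sum>m<N. (norm (s' m))\<^sup>2 * r ^ (2 * m)) \<le> (1 + \<epsilon>) * E"
      using \<epsilon> by (intro mult_left_mono) auto
    moreover have "(\<Sum>m\<le>N0. (norm (a m))\<^sup>2 * r ^ (2 * m)) \<le> (\<Sum>m<N. (norm (a m))\<^sup>2 * r ^ (2 * m))"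
      using N r by (intro sum_mono2) auto
    ultimately show ?thesis unfolding r_def by linarith
  qed
  have "(\<Sum>m\<le>N0. (norm (a m))\<^sup>2) \<le> E"
  proof (rule tendsto_le[of "at_right (0::real)"])
    have "((\<lambda>\<epsilon>. (1 + \<epsilon>) * E + \<epsilon> + \<epsilon>\<^sup>2) \<longlongrightarrow> (1 + 0) * E + 0 + 0\<^sup>2) (at_right (0::real))"
      by (intro tendsto_intros)
    then show "((\<lambda>\<epsilon>. (1 + \<epsilon>) * E + \<epsilon> + \<epsilon>\<^sup>2) \<longlongrightarrow> E) (at_right (0::real))" by simp
    have "((\<lambda>\<epsilon>. \<Sum>m\<le>N0. (norm (a m))\<^sup>2 * (1 - \<epsilon>) ^ (2 * m)) \<longlongrightarrow> (\<Sum>m\<le>N0. (norm (a m))\<^sup>2 * (1 - 0) ^ (2 * m))) (at_right (0::real))"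
      by (intro tendsto_intros)
    then show "((\<lambda>\<epsilon>. \<Sum>m\<le>N0. (norm (a m))\<^sup>2 * (1 - \<epsilon>) ^ (2 * m)) \<longlongrightarrow> (\<Sum>m\<le>N0. (norm (a m))\<^sup>2)) (at_right (0::real))"
      by simp
    show "\<forall>\<^sub>F \<epsilon> in at_right (0::real). (\<Sum>m\<le>N0. (norm (a m))\<^sup>2 * (1 - \<epsilon>) ^ (2 * m)) \<le> (1 + \<epsilon>) * E + \<epsilon> + \<epsilon>\<^sup>2"
      using eventually_at_right_real[of 0 1] by (rule eventually_mono) (use approx in auto)
  qed simp
  then show "(\<Sum>m\<le>N0. (norm (fps_nth (W * fps_cutoff M S) m))\<^sup>2) \<le> (\<Sum>m<M. (norm (fps_nth S m))\<^sup>2)"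
    by (simp add: a_def E_def)
qed

section \<open>Clunie's energy method\<close>

text \<open>The equation exhibits \<open>z * P'\<close> as \<open>- W\<close> times the series with coefficients
  \<open>(a + b * m) * P\<^sub>m\<close>; truncating that series at \<open>M\<close> makes the contraction property applicable.\<close>

lemma clunie_energy:
  fixes P W :: "complex fps" and a b :: real
  assumes W: "contractive W" "fps_nth W 0 = 0"
    and ode: "fps_X * fps_deriv P =
       - (W * (fps_const (of_real a) * P + fps_const (of_real b) * (fps_X * fps_deriv P)))"
  shows "(\<Sum>m\<le>M. (real m * norm (fps_nth P m))\<^sup>2) \<le> (\<Sum>m<M. ((a + b * real m) * norm (fps_nth P m))\<^sup>2)"
proof -
  define S where "S = fps_const (of_real a) * P + fps_const (of_real b) * (fps_X * fps_deriv P)"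
  have S: "fps_nth S m = of_real (a + b * real m) * fps_nth P m" for m
    unfolding S_def by (simp only: fps_add_nth fps_mult_left_const_nth fps_nth_X_mult_deriv)
       (simp add: algebra_simps)
  \<comment> \<open>As \<open>W\<close> has no constant term, coefficients up to \<open>M\<close> of \<open>W * S\<close> only see
    coefficients of \<open>S\<close> below \<open>M\<close>.\<close>
  have "fps_nth (W * S) m = fps_nth (W * fps_cutoff M S) m" if "m \<le> M" for m
    unfolding fps_mult_nth
  proof (rule sum.cong[OF refl])
    fix i assume "i \<in> {0..m}"
    then show "fps_nth W i * fps_nth S (m - i) = fps_nth W i * fps_nth (fps_cutoff M S) (m - i)"
      using that W(2) by (cases "i = 0") auto
  qed
  then have "(\<Sum>m\<le>M. (real m * norm (fps_nth P m))\<^sup>2) = (\<Sum>m\<le>M. (norm (fps_nth (W * fps_cutoff M S) m))\<^sup>2)"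
  proof (intro sum.cong[OF refl])
    fix m assume cut: "\<And>m. m \<le> M \<Longrightarrow> fps_nth (W * S) m = fps_nth (W * fps_cutoff M S) m" "m \<in> {..M}"
    have "of_nat m * fps_nth P m = - fps_nth (W * S) m"
      using arg_cong[OF ode, of "\<lambda>s. fps_nth s m"] unfolding fps_nth_X_mult_deriv S_def by simp
    then have "norm (of_nat m * fps_nth P m) = norm (fps_nth (W * fps_cutoff M S) m)"
      using cut by simp
    then show "(real m * norm (fps_nth P m))\<^sup>2 = (norm (fps_nth (W * fps_cutoff M S) m))\<^sup>2"
      by (simp add: norm_mult)
  qed
  also have "\<dots> \<le> (\<Sum>m<M. (norm (fps_nth S m))\<^sup>2)" using W(1) unfolding contractive_def by blast
  also have "\<dots> = (\<Sum>m<M. ((a + b * real m) * norm (fps_nth P m))\<^sup>2)"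
    by (intro sum.cong refl) (simp only: S norm_mult norm_of_real power_mult_distrib power2_abs)
  finally show ?thesis .
qed

text \<open>The majorant turns the energy inequality into an equality, because
  \<open>(m + 1) * Q (m + 1) = (a + b * m) * Q m\<close>.\<close>

lemma telescoping_product_energy:
  fixes a b :: real
  defines "Q \<equiv> \<lambda>m. \<Prod>j<m. (a + b * real j) / (real j + 1)"
  shows "(\<Sum>m<M. ((a + b * real m)\<^sup>2 - (real m)\<^sup>2) * (Q m)\<^sup>2) = (real M * Q M)\<^sup>2"
proof (induction M)
  case (Suc M)
  have "real (Suc M) * Q (Suc M) = (a + b * real M) * Q M"
    by (simp add: Q_def field_simps)
  then have "(real (Suc M) * Q (Suc M))\<^sup>2 = ((a + b * real M) * Q M)\<^sup>2" by (rule arg_cong)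
  then show ?case using Suc.IH by (simp only: sum.lessThan_Suc power_mult_distrib left_diff_distrib)
qed simp

text \<open>While the weight \<open>(a + b * j)\<^sup>2 - j\<^sup>2\<close> is nonnegative, larger earlier terms only weaken the
  bound, so the majorant follows by induction; once it is nonpositive, terms can be dropped and
  the bound on \<open>M * x M\<close> stays frozen at its value for \<open>M = L\<close>.\<close>

lemma energy_majorant:
  fixes a b :: real and x :: "nat \<Rightarrow> real"
  defines "Q \<equiv> \<lambda>m. \<Prod>j<m. (a + b * real j) / (real j + 1)"
  assumes x: "\<And>m. 0 \<le> x m" "x 0 = 1"
    and energy: "\<And>M. (\<Sum>m\<le>M. (real m * x m)\<^sup>2) \<le> (\<Sum>m<M. ((a + b * real m) * x m)\<^sup>2)"
    and big: "\<And>j. j < L \<Longrightarrow> real j \<le> a + b * real j"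
    and small: "\<And>j. L \<le> j \<Longrightarrow> \<bar>a + b * real j\<bar> \<le> real j"
  shows "m \<le> L \<Longrightarrow> x m \<le> Q m"
    and "L \<le> M \<Longrightarrow> real M * x M \<le> real L * Q L"
proof -
  have step: "(real M * x M)\<^sup>2 \<le> (\<Sum>m<M. ((a + b * real m)\<^sup>2 - (real m)\<^sup>2) * (x m)\<^sup>2)" for M
  proof -
    have "(\<Sum>m\<le>M. (real m * x m)\<^sup>2) = (\<Sum>m<M. (real m * x m)\<^sup>2) + (real M * x M)\<^sup>2"
      by (simp only: lessThan_Suc_atMost[symmetric] sum.lessThan_Suc)
    then show ?thesis using energy[of M]
      by (simp add: sum_subtractf left_diff_distrib power_mult_distrib)
  qed
  have pos: "0 \<le> (a + b * real j)\<^sup>2 - (real j)\<^sup>2" if "j < L" for j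
    using power_mono[OF big[OF that], of 2] by simp
  have neg: "(a + b * real j)\<^sup>2 - (real j)\<^sup>2 \<le> 0" if "L \<le> j" for j
    using power_mono[OF small[OF that], of 2] by simp
  have Qpos: "0 \<le> Q m" if "m \<le> L" for m
    unfolding Q_def
  proof (rule prod_nonneg)
    fix j assume "j \<in> {..<m}"
    then have "real j \<le> a + b * real j" using that big by simp
    then have "0 \<le> a + b * real j" using of_nat_0_le_iff[of j] by linarith
    then show "0 \<le> (a + b * real j) / (real j + 1)" by simp
  qed
  have le: "x m \<le> Q m" if "m \<le> L" for m
    using that
  proof (induction m rule: less_induct)
    case (less m)
    show ?case
    proof (cases "m = 0")
      case True then show ?thesis by (simp add: Q_def x)
    next
      case False
      have "(real m * x m)\<^sup>2 \<le> (\<Sum>i<m. ((a + b * real i)\<^sup>2 - (real i)\<^sup>2) * (x i)\<^sup>2)" by (rule step)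
      also have "\<dots> \<le> (\<Sum>i<m. ((a + b * real i)\<^sup>2 - (real i)\<^sup>2) * (Q i)\<^sup>2)"
        using less x pos by (intro sum_mono mult_left_mono power_mono) auto
      also have "\<dots> = (real m * Q m)\<^sup>2" unfolding Q_def by (rule telescoping_product_energy)
      finally have "real m * x m \<le> real m * Q m"
        by (rule power2_le_imp_le) (use Qpos less.prems in simp)
      then show ?thesis using False by simp
    qed
  qed
  then show "m \<le> L \<Longrightarrow> x m \<le> Q m" .
  show "real M * x M \<le> real L * Q L" if "L \<le> M"
  proof (rule power2_le_imp_le)
    let ?e = "\<lambda>m. (a + b * real m)\<^sup>2 - (real m)\<^sup>2"
    have "(real M * x M)\<^sup>2 \<le> (\<Sum>m<M. ?e m * (x m)\<^sup>2)" by (rule step)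
    also have "\<dots> \<le> (\<Sum>m<M. if m < L then ?e m * (Q m)\<^sup>2 else 0)"
      using pos neg le x by (intro sum_mono) (auto intro!: mult_left_mono power_mono simp: mult_nonpos_nonneg)
    also have "\<dots> = (\<Sum>m<L. ?e m * (Q m)\<^sup>2)"
    proof -
      have "{..<M} \<inter> {m. m < L} = {..<L}" using that by auto
      then show ?thesis by (simp add: sum.If_cases)
    qed
    also have "\<dots> = (real L * Q L)\<^sup>2" unfolding Q_def by (rule telescoping_product_energy)
    finally show "(real M * x M)\<^sup>2 \<le> (real L * Q L)\<^sup>2" .
  qed (use Qpos in simp)
qed

section \<open>Expansions at infinity as power series\<close>

text \<open>The power series of \<open>f z / z\<close> in the variable \<open>1 / z\<close>; the constant term is the leading \<open>1\<close> of the
  expansion.\<close>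

definition infinity_fps :: "(nat \<Rightarrow> complex) \<Rightarrow> complex fps" where
  "infinity_fps c = Abs_fps (\<lambda>n. if n = 0 then 1 else c n)"

lemma infinity_fps_nth: "fps_nth (infinity_fps c) 0 = 1" "fps_nth (infinity_fps c) (Suc n) = c (Suc n)"
  by (simp_all add: infinity_fps_def)

lemma expands_at_iff_sums:
  assumes "z \<noteq> 0"
  shows "expands_at f c z \<longleftrightarrow> (\<lambda>n. fps_nth (infinity_fps c) n * (1 / z) ^ n) sums (f z / z)"
proof -
  have "(\<lambda>n. fps_nth (infinity_fps c) n * (1 / z) ^ n) sums (f z / z)
    \<longleftrightarrow> (\<lambda>n. c (Suc n) / z ^ Suc n) sums (f z / z - 1)"
    using sums_Suc_iff[of "\<lambda>n. fps_nth (infinity_fps c) n * (1 / z) ^ n" "f z / z - 1"]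
    by (simp add: infinity_fps_nth power_divide del: power_Suc)
  also have "\<dots> \<longleftrightarrow> expands_at f c z"
    using assms unfolding expands_at_def sums_iff by (auto simp: field_simps)
  finally show ?thesis by simp
qed

lemma expands_at_imp:
  assumes "expands_at f c z" "z \<noteq> 0"
  shows "f z = z * eval_fps (infinity_fps c) (1 / z)"
    and "ereal (norm (1 / z)) \<le> fps_conv_radius (infinity_fps c)"
proof -
  note s = assms(1)[unfolded expands_at_iff_sums[OF assms(2)]]
  show "f z = z * eval_fps (infinity_fps c) (1 / z)"
    using sums_unique[OF s] assms(2) by (simp add: eval_fps_def field_simps)
  show "ereal (norm (1 / z)) \<le> fps_conv_radius (infinity_fps c)"
    unfolding fps_conv_radius_def by (rule conv_radius_geI) (use s in \<open>rule sums_summable\<close>)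
qed

lemma exterior_nonzero: "z \<in> exterior \<Longrightarrow> z \<noteq> 0"
  by (auto simp: exterior_def)

lemma has_fps_expansion_eval_fps:
  fixes F :: "complex fps"
  assumes "fps_conv_radius F > 0"
  shows "eval_fps F has_fps_expansion F"
  using assms by (simp add: has_fps_expansion_def)

lemma has_field_derivative_reflected:
  fixes h :: "complex \<Rightarrow> complex"
  assumes "(h has_field_derivative d) (at z)" "z \<noteq> 0"
  shows "((\<lambda>w. w * h (1 / w)) has_field_derivative h z - z * d) (at (1 / z))"
  using assms by (auto intro!: derivative_eq_intros DERIV_chain2[of h] simp: field_simps power2_eq_square)

lemma one_plus_mult_ne_0:
  fixes B :: real
  assumes "\<bar>B\<bar> \<le> 1" "norm (v::complex) < 1"
  shows "1 + of_real B * v \<noteq> 0"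
proof -
  have "\<bar>B\<bar> * norm v \<le> 1 * norm v" using assms by (intro mult_right_mono) auto
  then have "norm (of_real B * v) < 1" using assms by (simp add: norm_mult)
  then show ?thesis by (metis add_eq_0_iff norm_minus_cancel norm_one order_less_irrefl)
qed

text \<open>The subordination is a differential equation for \<open>h z = z * g (1 / z)\<close>, since
  \<open>g' (1 / z) = h z - z * h' z\<close> makes the starlikeness quotient equal to \<open>1 - z * h' z / h z\<close>.\<close>

lemma Sigma_star_ode:
  assumes AB: "-1 \<le> B" "B < A" "A \<le> 1" and g: "g \<in> Sigma_star A B"
  obtains b W where "\<forall>z\<in>exterior. expands_at g b z" "inj_on g exterior"
    "contractive W" "fps_nth W 0 = 0"
    "fps_X * fps_deriv (infinity_fps b) * (1 + fps_const (of_real B) * W)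
       = - (fps_const (of_real (A - B)) * (W * infinity_fps b))"
proof -
  from g obtain b where b: "\<And>z. z \<in> exterior \<Longrightarrow> expands_at g b z" and inj: "inj_on g exterior"
    unfolding Sigma_star_def Sigma_class_def by blast
  from g obtain \<omega> where hol: "\<omega> holomorphic_on ball 0 1" and \<omega>0: "\<omega> 0 = 0"
    and \<omega>b: "\<And>z. z \<in> ball 0 1 \<Longrightarrow> \<omega> z \<in> ball 0 1"
    and Q: "\<And>z. z \<in> ball 0 1 \<Longrightarrow> star_quotient g z = (1 + of_real A * \<omega> z) / (1 + of_real B * \<omega> z)"
    unfolding Sigma_star_def subordinate_def by blast
  define H where "H = infinity_fps b"
  define h where "h = eval_fps H"
  have H0: "fps_nth H 0 = 1" by (simp add: H_def infinity_fps_nth)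
  have gh: "g w = w * h (1 / w)" if "w \<in> exterior" for w
    using expands_at_imp(1)[OF b[OF that] exterior_nonzero[OF that]] by (simp add: h_def H_def)
  have rad: "fps_conv_radius H \<ge> 1"
    unfolding fps_conv_radius_def
  proof (rule conv_radius_geI_ex)
    fix r :: real assume r: "0 < r" "ereal r < 1"
    then have "of_real (1 / r) \<in> exterior" by (simp add: exterior_def norm_divide)
    from b[OF this] r have "summable (\<lambda>n. fps_nth H n * (1 / of_real (1 / r)) ^ n)"
      by (subst (asm) expands_at_iff_sums) (auto simp: H_def dest: sums_summable)
    then show "\<exists>z. norm z = r \<and> summable (\<lambda>n. fps_nth H n * z ^ n)"
      using r by (intro exI[of _ "of_real r"]) auto
  qed
  then have "fps_conv_radius H > 0" by (rule less_le_trans[rotated]) simp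
  then have hH: "h has_fps_expansion H" unfolding h_def by (rule has_fps_expansion_eval_fps)
  have h0: "h 0 = 1" by (simp add: h_def eval_fps_at_0 H0)
  have dh: "(h has_field_derivative deriv h z) (at z)" if "norm z < 1" for z
  proof -
    have "h holomorphic_on eball 0 1"
      unfolding h_def by (rule holomorphic_on_subset[OF holomorphic_on_eval_fps[OF order_refl] eball_mono[OF rad]])
    then show ?thesis by (rule holomorphic_derivI) (use that in auto)
  qed
  define W where "W = fps_expansion \<omega> 0"
  have W: "\<omega> has_fps_expansion W"
    unfolding W_def by (rule has_fps_expansion_fps_expansion[OF _ _ hol]) auto
  have contr: "contractive W"
    by (rule bounded_imp_contractive[OF hol _ W]) (use \<omega>b in \<open>force intro: less_imp_le\<close>)
  have W0: "fps_nth W 0 = 0"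
    using has_fps_expansion_imp_0_eq_fps_nth_0[OF W] \<omega>0 by simp
  \<comment> \<open>Comparing power series needs the equation only near \<open>0\<close>, where \<open>h\<close> has no zero.\<close>
  have ode: "z * deriv h z * (1 + of_real B * \<omega> z) = - (of_real (A - B) * (\<omega> z * h z))"
    if z: "z \<in> ball 0 1" "h z \<noteq> 0" for z
  proof (cases "z = 0")
    case True then show ?thesis by (simp add: \<omega>0)
  next
    case False
    then have ext: "1 / z \<in> exterior" using z by (simp add: exterior_def norm_divide field_simps)
    have "((\<lambda>w. w * h (1 / w)) has_field_derivative h z - z * deriv h z) (at (1 / z))"
      using dh[of z] z False by (intro has_field_derivative_reflected) auto
    then have "(g has_field_derivative h z - z * deriv h z) (at (1 / z))"
    proof (rule has_field_derivative_transform_within_open)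
      show "open exterior" unfolding exterior_def by (intro open_Collect_less continuous_intros)
    qed (use ext gh in auto)
    then have "deriv g (1 / z) = h z - z * deriv h z" by (rule DERIV_imp_deriv)
    then have "star_quotient g z = (h z - z * deriv h z) / h z"
      using False gh[OF ext] by (simp add: star_quotient_def)
    then have eq: "(h z - z * deriv h z) / h z = (1 + of_real A * \<omega> z) / (1 + of_real B * \<omega> z)"
      using Q z by simp
    have "1 + of_real B * \<omega> z \<noteq> 0"
      by (rule one_plus_mult_ne_0) (use AB \<omega>b[OF z(1)] in auto)
    then have "(h z - z * deriv h z) * (1 + of_real B * \<omega> z) = (1 + of_real A * \<omega> z) * h z"
      using eq z(2) by (simp add: frac_eq_eq)
    then show ?thesis by (simp add: algebra_simps)
  qed
  have "eventually (\<lambda>z. h z \<noteq> 0) (nhds 0)"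
  proof -
    have "isCont h 0" using dh[of 0] by (intro DERIV_isCont) auto
    then have "(h \<longlongrightarrow> h 0) (nhds 0)" by (simp add: isCont_def tendsto_at_iff_tendsto_nhds)
    then show ?thesis using h0 by (intro tendsto_imp_eventually_ne) auto
  qed
  moreover have "eventually (\<lambda>z. z \<in> ball 0 1) (nhds (0::complex))" by (intro eventually_nhds_in_open) auto
  ultimately have ev: "eventually (\<lambda>z. z * deriv h z * (1 + of_real B * \<omega> z) = - (of_real (A - B) * (\<omega> z * h z))) (nhds 0)"
    by eventually_elim (rule ode)
  have "(\<lambda>z. z * deriv h z * (1 + of_real B * \<omega> z)) has_fps_expansion
      fps_X * fps_deriv H * (1 + fps_const (of_real B) * W)"
    by (intro fps_expansion_intros hH W)
  moreover have "(\<lambda>z. - (of_real (A - B) * (\<omega> z * h z))) has_fps_expansion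
      - (fps_const (of_real (A - B)) * (W * H))"
    by (intro fps_expansion_intros hH W)
  ultimately have "fps_X * fps_deriv H * (1 + fps_const (of_real B) * W) = - (fps_const (of_real (A - B)) * (W * H))"
    using has_fps_expansion_cong[OF ev refl] fps_expansion_unique_complex by blast
  then show thesis using that[OF _ inj contr W0] b unfolding H_def by blast
qed

lemma ode_power:
  fixes H W :: "'a::comm_ring_1 fps"
  assumes "fps_X * fps_deriv H * (1 + fps_const b * W) = - (fps_const d * (W * H))"
  shows "fps_X * fps_deriv (H ^ n) = - (W * (fps_const (of_nat n * d) * H ^ n + fps_const b * (fps_X * fps_deriv (H ^ n))))"
proof (cases n)
  case (Suc k)
  have "fps_X * fps_deriv (H ^ n) * (1 + fps_const b * W)
      = of_nat n * H ^ k * (fps_X * fps_deriv H * (1 + fps_const b * W))"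
    unfolding Suc by (simp only: fps_deriv_power diff_Suc_1 fps_of_nat mult_ac)
  also have "\<dots> = - (fps_const (of_nat n * d) * (W * H ^ n))"
    unfolding assms fps_const_mult[symmetric] fps_of_nat Suc by (simp add: mult_ac)
  finally have eq: "fps_X * fps_deriv (H ^ n) * (1 + fps_const b * W) = - (fps_const (of_nat n * d) * (W * H ^ n))" .
  have "fps_X * fps_deriv (H ^ n) + W * (fps_const (of_nat n * d) * H ^ n + fps_const b * (fps_X * fps_deriv (H ^ n)))
      = fps_X * fps_deriv (H ^ n) * (1 + fps_const b * W) + fps_const (of_nat n * d) * (W * H ^ n)"
    by (simp add: algebra_simps)
  also have "\<dots> = 0" unfolding eq by simp
  finally have "fps_X * fps_deriv (H ^ n) + W * (fps_const (of_nat n * d) * H ^ n + fps_const b * (fps_X * fps_deriv (H ^ n))) = 0" .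
  then show ?thesis by (rule eq_neg_iff_add_eq_0[THEN iffD2])
next
  case 0
  show ?thesis unfolding 0 by simp
qed

text \<open>In terms of \<open>h\<close> and \<open>k u = u * G (1 / u)\<close>, the identity \<open>G (g (1 / z)) = 1 / z\<close> reads
  \<open>k (z / h z) = 1 / h z\<close>, the hypothesis of Lagrange inversion.\<close>

lemma inverse_coefficient_relation:
  assumes b: "\<And>z. z \<in> exterior \<Longrightarrow> expands_at g b z" and inj: "inj_on g exterior"
    and inv: "inverse_near_infinity g G c"
  shows "infinity_fps c oo (fps_X * inverse (infinity_fps b)) = inverse (infinity_fps b)"
proof -
  define H where "H = infinity_fps b"
  define K where "K = infinity_fps c"
  define h where "h = eval_fps H"
  define k where "k = eval_fps K"
  have H0: "fps_nth H 0 = 1" "fps_nth K 0 = 1" by (simp_all add: H_def K_def infinity_fps_nth)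
  have h0: "h 0 = 1" "k 0 = 1" by (simp_all add: h_def k_def eval_fps_at_0 H0)
  obtain R where R: "\<And>w. norm w \<ge> R \<Longrightarrow> G w \<in> exterior \<and> g (G w) = w \<and> expands_at G c w"
    using inv unfolding inverse_near_infinity_def eventually_at_infinity by blast
  have gh: "g w = w * h (1 / w)" if "w \<in> exterior" for w
    using expands_at_imp(1)[OF b[OF that] exterior_nonzero[OF that]] by (simp add: h_def H_def)
  have Gk: "G w = w * k (1 / w)" if "norm w \<ge> R" "w \<noteq> 0" for w
    using expands_at_imp(1) R[OF that(1)] that by (auto simp: k_def K_def)
  have "fps_conv_radius H > 0"
  proof -
    have "ereal (1 / 2) \<le> fps_conv_radius H"
      using expands_at_imp(2)[OF b[of 2]] by (simp add: exterior_def H_def)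
    then show ?thesis by (rule less_le_trans[rotated]) simp
  qed
  then have hH: "h has_fps_expansion H" unfolding h_def by (rule has_fps_expansion_eval_fps)
  have "fps_conv_radius K > 0"
  proof -
    define w where "w = complex_of_real (max 1 R)"
    have w: "norm w \<ge> R" "w \<noteq> 0" by (auto simp: w_def)
    then have "ereal (norm (1 / w)) \<le> fps_conv_radius K"
      using expands_at_imp(2) R[OF w(1)] unfolding K_def by blast
    moreover have "0 < ereal (norm (1 / w))" using w by simp
    ultimately show ?thesis by (rule less_le_trans[rotated])
  qed
  then have kK: "k has_fps_expansion K" unfolding k_def by (rule has_fps_expansion_eval_fps)
  have hc: "(h \<longlongrightarrow> 1) (at 0)"
  proof -
    have "isCont h 0" using has_fps_expansion_imp_continuous[OF hH, of UNIV] by simp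
    then show ?thesis by (simp add: isCont_def h0)
  qed
  have inf: "filterlim (\<lambda>z. h z / z) at_infinity (at 0)"
    by (rule filterlim_divide_at_infinity[of _ 1])
       (use hc in \<open>auto simp: filterlim_at eventually_at_filter\<close>)
  have "eventually (\<lambda>z. k (z * inverse (h z)) = inverse (h z)) (at 0)"
  proof -
    have "eventually (\<lambda>z. R \<le> norm (h z / z)) (at 0)"
      using filterlim_at_infinity_imp_norm_at_top[OF inf] by (simp add: filterlim_at_top)
    moreover have "eventually (\<lambda>z. h z \<noteq> 0) (at 0)"
      using hc by (rule tendsto_imp_eventually_ne) simp
    moreover have "eventually (\<lambda>z. z \<in> ball 0 1 - {0}) (at (0::complex))"
      by (rule eventually_at_in_open) auto
    ultimately show ?thesis
    proof eventually_elim
      case (elim z)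
      then have z: "z \<noteq> 0" "norm z < 1" by auto
      then have ext: "1 / z \<in> exterior" by (simp add: exterior_def norm_divide field_simps)
      have w: "g (1 / z) = h z / z" using gh[OF ext] by simp
      \<comment> \<open>A right inverse of the injective \<open>g\<close> is also a left inverse.\<close>
      have "g (G (h z / z)) = g (1 / z)" "G (h z / z) \<in> exterior"
        using R elim(1) w by auto
      then have "G (h z / z) = 1 / z" using inj ext by (auto dest: inj_onD)
      then show ?case using Gk[OF elim(1)] elim(2) z by (simp add: field_simps)
    qed
  qed
  then have ev: "eventually (\<lambda>z. (k \<circ> (\<lambda>z. z * inverse (h z))) z = inverse (h z)) (nhds 0)"
    by (simp add: eventually_nhds_conv_at h0)
  have "(k \<circ> (\<lambda>z. z * inverse (h z))) has_fps_expansion (K oo (fps_X * inverse H))"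
    by (intro fps_expansion_intros hH kK) (simp_all add: H0)
  moreover have "(\<lambda>z. inverse (h z)) has_fps_expansion inverse H"
    by (intro fps_expansion_intros hH) (simp_all add: H0)
  ultimately show ?thesis
    using has_fps_expansion_cong[OF ev refl] fps_expansion_unique_complex unfolding H_def K_def by blast
qed

lemma inverse_coefficients:
  assumes "\<And>z. z \<in> exterior \<Longrightarrow> expands_at g b z" "inj_on g exterior" "inverse_near_infinity g G c"
  shows "c 1 = - fps_nth (infinity_fps b) 1"
    and "of_nat n * c (Suc n) = - fps_nth (infinity_fps b ^ n) (Suc n)"
proof -
  note lagrange = lagrange_inversion_at_infinity[OF infinity_fps_nth(1) inverse_coefficient_relation[OF assms]]
  show "c 1 = - fps_nth (infinity_fps b) 1"
    using lagrange(1) infinity_fps_nth(2)[of c 0] by simp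
  show "of_nat n * c (Suc n) = - fps_nth (infinity_fps b ^ n) (Suc n)"
    using lagrange(2)[of n] unfolding infinity_fps_nth(2) .
qed

section \<open>Bounds for the inverse coefficients\<close>

text \<open>The first coefficient comes from the initial range of the majorant, which for \<open>n = 1\<close>
  reaches exactly \<open>m = 1\<close>.\<close>

lemma inverse_coefficient_bound:
  assumes AB: "-1 \<le> B" "B < A" "A \<le> 1" and g: "g \<in> Sigma_star A B"
    and inv: "inverse_near_infinity g G c"
    and n: "0 < n" "k < n" and \<delta>: "delta A B \<in> I_interval n k"
  shows "norm (c (n + 1)) \<le> (real n - real k) / (real n * (real n + 1)) *
             (\<Prod>j = 0..n - k - 1. (real n * (A - B) + B * real j) / (real j + 1))"
    and "n = 1 \<Longrightarrow> norm (c 1) \<le> A - B"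
proof -
  obtain b W where b_all: "\<forall>z\<in>exterior. expands_at g b z" and inj: "inj_on g exterior"
    and W: "contractive W" "fps_nth W 0 = 0"
    and ode: "fps_X * fps_deriv (infinity_fps b) * (1 + fps_const (of_real B) * W)
       = - (fps_const (of_real (A - B)) * (W * infinity_fps b))"
    by (rule Sigma_star_ode[OF AB g])
  have b: "expands_at g b z" if "z \<in> exterior" for z using b_all that by blast
  define a where "a = real n * (A - B)"
  define P where "P = infinity_fps b ^ n"
  define x where "x = (\<lambda>m. norm (fps_nth P m))"
  define L where "L = n - k"
  have "fps_X * fps_deriv P = - (W * (fps_const (of_real a) * P + fps_const (of_real B) * (fps_X * fps_deriv P)))"
    using ode_power[OF ode, of n] by (simp add: P_def a_def)
  from clunie_energy[OF W this]
  have energy: "(\<Sum>m\<le>M. (real m * x m)\<^sup>2) \<le> (\<Sum>m<M. ((a + B * real m) * x m)\<^sup>2)" for M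
    unfolding x_def .
  have x0: "x 0 = 1" by (simp add: x_def P_def fps_nth_power_0 infinity_fps_nth)
  have aB: "0 \<le> a" "0 < 1 - B" using AB by (simp_all add: a_def)
  have nd: "a = (1 - B) * (real n - real n * delta A B)" using aB(2) by (simp add: delta_def a_def field_simps)
  \<comment> \<open>\<open>a + B j - j\<close> changes sign at \<open>j = a / (1 - B) = n (1 - \<delta>)\<close>, which the hypothesis on
    \<open>\<delta>\<close> places in \<open>(L - 1, L]\<close>.\<close>
  have L: "real L - 1 < real n - real n * delta A B" "real n - real n * delta A B \<le> real L"
    using \<delta> n by (auto simp: I_interval_def L_def field_simps of_nat_diff)
  have big: "real j \<le> a + B * real j" if "j < L" for j
  proof -
    have "(1 - B) * real j \<le> a" unfolding nd using that L(1) aB(2) by (intro mult_left_mono) auto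
    then show ?thesis by (simp add: algebra_simps)
  qed
  have small: "\<bar>a + B * real j\<bar> \<le> real j" if "L \<le> j" for j
  proof -
    have "a \<le> (1 - B) * real j" unfolding nd using that L(2) aB(2) by (intro mult_left_mono) auto
    moreover have "-1 * real j \<le> B * real j" using AB by (intro mult_right_mono) auto
    ultimately show ?thesis using aB(1) by (simp add: algebra_simps abs_le_iff)
  qed
  note maj = energy_majorant[of x a B L, OF _ x0 energy big small]
  have x_nonneg: "0 \<le> x m" for m by (simp add: x_def)
  have c: "real n * norm (c (Suc n)) = x (Suc n)"
    using arg_cong[OF inverse_coefficients(2)[OF b inj inv, of n], of norm] by (simp add: norm_mult x_def P_def)
  have "real (Suc n) * x (Suc n) \<le> real L * (\<Prod>j<L. (a + B * real j) / (real j + 1))"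
    using maj(2)[of "Suc n"] x_nonneg by (simp add: L_def)
  moreover have "{..<L} = {0..n - k - 1}" using n by (auto simp: L_def)
  moreover have "real L = real n - real k" using n by (simp add: L_def of_nat_diff)
  ultimately have "real (Suc n) * (real n * norm (c (Suc n))) \<le> (real n - real k) * (\<Prod>j = 0..n - k - 1. (a + B * real j) / (real j + 1))"
    using c by simp
  then have "norm (c (n + 1)) * (real n * (real n + 1)) \<le> (real n - real k) * (\<Prod>j = 0..n - k - 1. (a + B * real j) / (real j + 1))"
    by (simp add: mult_ac add.commute)
  then show "norm (c (n + 1)) \<le> (real n - real k) / (real n * (real n + 1)) *
             (\<Prod>j = 0..n - k - 1. (real n * (A - B) + B * real j) / (real j + 1))"
    using n unfolding a_def times_divide_eq_left by (subst pos_le_divide_eq) simp_all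
  show "norm (c 1) \<le> A - B" if "n = 1"
  proof -
    have "x 1 \<le> (\<Prod>j<1. (a + B * real j) / (real j + 1))"
      using maj(1)[of 1] x_nonneg that n by (simp add: L_def)
    then have "x 1 \<le> A - B" using that by (simp add: a_def)
    then show ?thesis using inverse_coefficients(1)[OF b inj inv] that by (simp add: x_def P_def)
  qed
qed

section \<open>Univalence of starlike functions\<close>

text \<open>Along the segment from \<open>a\<close> to \<open>b\<close>, the real part of \<open>L / (b - a)\<close> increases strictly.\<close>

lemma Noshiro_Warschawski:
  assumes "convex S" and L: "\<And>s. s \<in> S \<Longrightarrow> (L has_field_derivative L' s) (at s)"
    and pos: "\<And>s. s \<in> S \<Longrightarrow> Re (L' s) > 0"
  shows "inj_on L S"
proof (rule inj_onI, rule ccontr)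
  fix a b assume ab: "a \<in> S" "b \<in> S" "L a = L b" "a \<noteq> b"
  define p where "p = (\<lambda>t::real. a + of_real t * (b - a))"
  define \<phi> where "\<phi> = (\<lambda>t. Re (L (p t) / (b - a)))"
  have pS: "p t \<in> S" if "0 \<le> t" "t \<le> 1" for t
    using convexD_alt[OF assms(1) ab(1,2) that] by (simp add: p_def scaleR_conv_of_real algebra_simps)
  have "\<phi> 0 < \<phi> 1"
  proof (rule DERIV_pos_imp_increasing[of 0 1 \<phi>])
    fix t :: real assume t: "0 \<le> t" "t \<le> 1"
    have "(p has_vector_derivative (b - a)) (at t)"
      unfolding p_def by (auto intro!: derivative_eq_intros)
    from field_vector_diff_chain_at[OF this L[OF pS[OF t]]]
    have "((\<lambda>t. L (p t)) has_vector_derivative (b - a) * L' (p t)) (at t)" by (simp add: o_def)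
    then have "((\<lambda>t. L (p t) / (b - a)) has_vector_derivative ((b - a) * L' (p t)) / (b - a)) (at t)"
      by (rule bounded_linear.has_vector_derivative[OF bounded_linear_divide])
    then have "((\<lambda>t. L (p t) / (b - a)) has_vector_derivative L' (p t)) (at t)" using ab by simp
    then have "(\<phi> has_vector_derivative Re (L' (p t))) (at t)"
      unfolding \<phi>_def by (rule bounded_linear.has_vector_derivative[OF bounded_linear_Re])
    then show "\<exists>y. DERIV \<phi> t :> y \<and> y > 0"
      using pos[OF pS[OF t]] by (auto simp: has_real_derivative_iff_has_vector_derivative)
  qed simp
  then show False using ab by (simp add: \<phi>_def p_def)
qed

lemma starlike_imp_inj_on:
  assumes q: "\<And>z. z \<in> ball 0 1 \<Longrightarrow> (q has_field_derivative q' z) (at z)"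
    and pos: "\<And>z. z \<in> ball 0 1 \<Longrightarrow> Re (1 + z * q' z) > 0"
  shows "inj_on (\<lambda>z. z * exp (q z)) (ball 0 1)"
proof (rule inj_onI)
  fix z1 z2 assume z: "z1 \<in> ball 0 1" "z2 \<in> ball 0 1" and eq: "z1 * exp (q z1) = z2 * exp (q z2)"
  show "z1 = z2"
  proof (cases "z1 = 0 \<or> z2 = 0")
    case True then show ?thesis using eq by auto
  next
    case False
    \<comment> \<open>With \<open>z = exp s\<close>, \<open>L s\<close> is a logarithm of \<open>z * exp (q z)\<close>, and its derivative is the
    starlikeness quotient.\<close>
    define L where "L = (\<lambda>s. s + q (exp s))"
    have inj: "inj_on L {s. Re s < 0}"
    proof (rule Noshiro_Warschawski)
      show "convex {s. Re s < 0}" by (rule convex_halfspace_Re_lt)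
      fix s assume "s \<in> {s. Re s < 0}"
      then have b: "exp s \<in> ball 0 1" by simp
      show "(L has_field_derivative 1 + exp s * q' (exp s)) (at s)"
        unfolding L_def
        by (auto intro!: derivative_eq_intros DERIV_chain2[where f = q and g = exp, OF q[OF b]])
      show "Re (1 + exp s * q' (exp s)) > 0" by (rule pos[OF b])
    qed
    have "exp (L (Ln z1)) = exp (L (Ln z2))" using eq False by (simp add: L_def exp_add)
    then obtain i :: int where "L (Ln z1) = L (Ln z2) + of_int (2 * i) * pi * \<i>"
      unfolding exp_eq by auto
    \<comment> \<open>\<open>L\<close> commutes with the period of \<open>exp\<close>, so the period can be moved into the argument.\<close>
    moreover define s where "s = Ln z2 + of_int (2 * i) * pi * \<i>"
    have es: "exp s = z2"
      using exp_integer_2pi[of "of_int i"] False by (simp add: s_def exp_add mult_ac)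
    ultimately have "L (Ln z1) = L s" using False by (simp add: L_def s_def[symmetric]) (simp add: s_def)
    moreover have "Re (Ln z1) < 0" "Re s < 0"
    proof -
      show "Re (Ln z1) < 0" using False z by simp
      have "norm (exp s) < 1" using es z by simp
      then show "Re s < 0" by simp
    qed
    ultimately have "Ln z1 = s" using inj by (auto dest: inj_onD)
    then show ?thesis using es False by (metis exp_Ln)
  qed
qed

lemma Re_Janowski_pos:
  fixes A B :: real
  assumes "\<bar>A\<bar> \<le> 1" "\<bar>B\<bar> \<le> 1" "norm (v::complex) < 1"
  shows "Re ((1 + of_real A * v) / (1 + of_real B * v)) > 0"
proof -
  define r where "r = norm v"
  have r: "\<bar>Re v\<bar> \<le> r" "0 \<le> r" "r < 1" using assms abs_Re_le_cmod by (auto simp: r_def)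
  have rr: "(Re v)\<^sup>2 + (Im v)\<^sup>2 = r\<^sup>2" by (simp add: r_def cmod_power2)
  have Ar: "\<bar>A * r\<bar> < 1" "\<bar>B * r\<bar> < 1"
    using mult_right_mono[of "\<bar>A\<bar>" 1 r] mult_right_mono[of "\<bar>B\<bar>" 1 r] assms r by (auto simp: abs_mult)
  have "0 < (1 + A * r) * (1 + B * r)" "0 < (1 - A * r) * (1 - B * r)"
    using Ar by (auto intro!: mult_pos_pos)
  then have "\<bar>(A + B) * r\<bar> < 1 + A * B * r\<^sup>2" by (simp add: abs_less_iff algebra_simps power2_eq_square)
  moreover have "\<bar>(A + B) * Re v\<bar> \<le> \<bar>(A + B) * r\<bar>" using r by (simp add: abs_mult mult_left_mono)
  ultimately have "0 < 1 + (A + B) * Re v + A * B * r\<^sup>2" by linarith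
  also have "\<dots> = Re ((1 + of_real A * v) * cnj (1 + of_real B * v))"
    unfolding rr[symmetric] by (simp add: algebra_simps power2_eq_square)
  finally have "0 < Re ((1 + of_real A * v) * cnj (1 + of_real B * v))" .
  then show ?thesis
    using one_plus_mult_ne_0[OF assms(2,3)] by (subst complex_div_cnj) (simp add: divide_pos_pos Re_divide_of_real)
qed

section \<open>The extremal functions\<close>

lemma normalized_infinity_fps:
  "fps_nth S 0 = 1 \<Longrightarrow> infinity_fps (fps_nth S) = S"
  by (intro fps_ext) (simp add: infinity_fps_def)

lemma exterior_inverse: "z \<in> exterior \<Longrightarrow> 1 / z \<in> ball 0 1"
  by (auto simp: exterior_def norm_divide divide_less_eq_1)

lemma expands_at_fps_expansion:
  assumes "k holomorphic_on ball 0 r" "k 0 = 1" "1 / w \<in> ball 0 r" "w \<noteq> 0"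
  shows "expands_at (\<lambda>w. w * k (1 / w)) (fps_nth (fps_expansion k 0)) w"
proof -
  have "infinity_fps (fps_nth (fps_expansion k 0)) = fps_expansion k 0"
    by (rule normalized_infinity_fps) (simp add: fps_expansion_def assms(2))
  moreover have "(\<lambda>n. (deriv ^^ n) k 0 / fact n * (1 / w - 0) ^ n) sums k (1 / w)"
    by (rule holomorphic_power_series[OF assms(1,3)])
  ultimately show ?thesis
    unfolding expands_at_iff_sums[OF assms(4)] using assms(4) by (simp add: fps_expansion_def)
qed

text \<open>The logarithm \<open>q\<close> of \<open>f z / z\<close>, where \<open>f z = 1 / g (1 / z)\<close>, is the convenient parameter: the
  starlikeness quotient of \<open>g\<close> becomes \<open>1 + z * q' z\<close>, and \<open>g\<close> has no zeros by construction.\<close>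

definition reflected_exp :: "(complex \<Rightarrow> complex) \<Rightarrow> complex \<Rightarrow> complex" where
  "reflected_exp q z = z * exp (- q (1 / z))"

lemma reflected_exp_eq: "reflected_exp q z = 1 / (1 / z * exp (q (1 / z)))"
  by (simp add: reflected_exp_def exp_minus field_simps)

context
  fixes q :: "complex \<Rightarrow> complex"
  assumes q_hol: "q holomorphic_on ball 0 1" and q0: "q 0 = 0"
    and f_inj: "inj_on (\<lambda>z. z * exp (q z)) (ball 0 1)"
begin

lemma reflected_exp_expands_at:
  assumes "z \<in> exterior"
  shows "expands_at (reflected_exp q) (fps_nth (fps_expansion (\<lambda>z. exp (- q z)) 0)) z"
  unfolding reflected_exp_def
  by (rule expands_at_fps_expansion[OF _ _ exterior_inverse[OF assms] exterior_nonzero[OF assms]])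
     (auto intro!: holomorphic_intros q_hol simp: q0)

lemma reflected_exp_inj_on: "inj_on (reflected_exp q) exterior"
proof (rule inj_onI)
  fix z1 z2 assume z: "z1 \<in> exterior" "z2 \<in> exterior" and "reflected_exp q z1 = reflected_exp q z2"
  then have "1 / z1 * exp (q (1 / z1)) = 1 / z2 * exp (q (1 / z2))"
    unfolding reflected_exp_eq divide_cancel_left by simp
  then have "1 / z1 = 1 / z2" by (rule inj_onD[OF f_inj _ z(1,2)[THEN exterior_inverse]])
  then show "z1 = z2" by simp
qed

lemma reflected_exp_in_Sigma_class: "reflected_exp q \<in> Sigma_class"
proof -
  have "(\<lambda>z. q (1 / z)) holomorphic_on exterior"
    using exterior_inverse exterior_nonzero
    by (intro holomorphic_on_compose_gen[OF _ q_hol, unfolded o_def]) (auto intro!: holomorphic_intros)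
  then have "reflected_exp q holomorphic_on exterior" unfolding reflected_exp_def by (intro holomorphic_intros)
  then show ?thesis
    unfolding Sigma_class_def using reflected_exp_inj_on reflected_exp_expands_at by blast
qed

text \<open>If \<open>F\<close> inverts \<open>f\<close> near \<open>0\<close>, then \<open>1 / F (1 / w)\<close> inverts \<open>g\<close> near infinity, and
  \<open>u / F u = exp (q (F u))\<close> is holomorphic at \<open>0\<close> with value \<open>1\<close>; its power series gives the
  expansion of the inverse.\<close>

lemma reflected_exp_inverse: "\<exists>G c. inverse_near_infinity (reflected_exp q) G c"
proof -
  define f where "f = (\<lambda>z. z * exp (q z))"
  define g where "g = reflected_exp q"
  have gf: "g z = 1 / f (1 / z)" for z by (simp add: g_def f_def reflected_exp_eq)
  have f_hol: "f holomorphic_on ball 0 1" unfolding f_def by (intro holomorphic_intros q_hol)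
  note f_inj = f_inj[folded f_def]
  have f0: "f 0 = 0" by (simp add: f_def)
  obtain F where F: "F holomorphic_on f ` ball 0 1" "\<And>z. z \<in> ball 0 1 \<Longrightarrow> F (f z) = z"
    using holomorphic_has_inverse[OF f_hol open_ball f_inj] by metis
  have "open (f ` ball 0 1)" by (rule open_mapping_thm3[OF f_hol open_ball f_inj])
  moreover have "0 \<in> f ` ball 0 1" using f0 by (intro image_eqI[of _ _ 0]) auto
  ultimately obtain r where r: "r > 0" "ball 0 r \<subseteq> f ` ball 0 1" by (meson openE)
  define k where "k = (\<lambda>u. exp (q (F u)))"
  have k_hol: "k holomorphic_on ball 0 r"
  proof -
    have "(q \<circ> F) holomorphic_on f ` ball 0 1"
      by (rule holomorphic_on_compose_gen[OF F(1) q_hol]) (use F(2) in auto)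
    then have "(q \<circ> F) holomorphic_on ball 0 r" using r(2) by (rule holomorphic_on_subset)
    then show ?thesis unfolding k_def o_def by (intro holomorphic_intros)
  qed
  have k0: "k 0 = 1" using F(2)[of 0] by (simp add: k_def f0 q0)
  define c where "c = fps_nth (fps_expansion k 0)"
  define G where "G = (\<lambda>w. w * k (1 / w))"
  have "G w \<in> exterior \<and> g (G w) = w \<and> expands_at G c w" if w: "2 / r \<le> norm w" for w
  proof -
    have "0 < 2 / r" using r by simp
    then have w0: "w \<noteq> 0" using w by auto
    have u: "1 / w \<in> ball 0 r"
    proof -
      have "2 \<le> norm w * r" using w r by (simp add: field_simps)
      then show ?thesis using w0 r by (simp add: norm_divide field_simps)
    qed
    then obtain v where v: "v \<in> ball 0 1" "f v = 1 / w" using r(2) by (metis imageE subsetD)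
    have Fv: "F (1 / w) = v" using F(2)[OF v(1)] v(2) by simp
    have v0: "v \<noteq> 0" using v(2) w0 f0 by auto
    have Gw: "G w = 1 / v"
      using v(2) v0 w0 by (simp add: G_def k_def Fv f_def field_simps)
    have "G w \<in> exterior" using v(1) v0 by (simp add: Gw exterior_def norm_divide field_simps)
    moreover have "g (G w) = w" using v(2) by (simp add: gf Gw)
    moreover have "expands_at G c w"
      unfolding G_def c_def by (rule expands_at_fps_expansion[OF k_hol k0 u w0])
    ultimately show ?thesis by blast
  qed
  then have "inverse_near_infinity g G c"
    unfolding inverse_near_infinity_def eventually_at_infinity by blast
  then show ?thesis unfolding g_def by blast
qed

end

text \<open>For \<open>\<omega> z = z ^ m\<close> the differential equation for \<open>P = h ^ n\<close> is explicit, and its coefficient at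
  \<open>z ^ m\<close> involves only \<open>P 0 = 1\<close>.  Lagrange inversion uses \<open>n = m - 1\<close>, except for \<open>m = 1\<close>,
  where \<open>c 1\<close> is read off from \<open>h\<close> itself.\<close>

lemma extremal_function:
  fixes A B :: real and m :: nat
  assumes AB: "-1 \<le> B" "B < A" "A \<le> 1" and m: "0 < m"
  shows "\<exists>g\<in>Sigma_star A B. \<exists>G c. inverse_near_infinity g G c \<and> norm (c m) = (A - B) / real m"
proof -
  have AB1: "\<bar>A\<bar> \<le> 1" "\<bar>B\<bar> \<le> 1" using AB by auto
  \<comment> \<open>\<open>q'\<close> is chosen so that \<open>1 + z * q' z = (1 + A * z ^ m) / (1 + B * z ^ m)\<close>.\<close>
  define q' where "q' = (\<lambda>z::complex. of_real (A - B) * z ^ (m - 1) / (1 + of_real B * z ^ m))"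
  have pow: "norm (z ^ m) < 1" if "z \<in> ball 0 1" for z :: complex
    using that m by (simp add: norm_power power_less_one_iff)
  have ne: "1 + of_real B * z ^ m \<noteq> 0" if "z \<in> ball 0 1" for z :: complex
    by (rule one_plus_mult_ne_0[OF AB1(2) pow[OF that]])
  have zm: "z * z ^ (m - 1) = z ^ m" for z :: complex using m by (cases m) auto
  have q'eq: "1 + z * q' z = (1 + of_real A * z ^ m) / (1 + of_real B * z ^ m)" if "z \<in> ball 0 1" for z
  proof -
    have "z * q' z = of_real (A - B) * z ^ m / (1 + of_real B * z ^ m)"
      unfolding q'_def zm[symmetric] by simp
    then show ?thesis using ne[OF that] by (simp add: field_simps)
  qed
  have "q' holomorphic_on ball 0 1"
    unfolding q'_def by (intro holomorphic_intros) (use ne in auto)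
  then obtain q0 where "\<And>z. z \<in> ball 0 1 \<Longrightarrow> (q0 has_field_derivative q' z) (at z within ball 0 1)"
    using holomorphic_convex_primitive'[of "ball 0 1" q'] by auto
  then have q0: "(q0 has_field_derivative q' z) (at z)" if "z \<in> ball 0 1" for z
    using that at_within_open[OF that open_ball] by metis
  define q where "q = (\<lambda>z. q0 z - q0 0)"
  have q: "(q has_field_derivative q' z) (at z)" if "z \<in> ball 0 1" for z
    unfolding q_def using q0[OF that] by (auto intro!: derivative_eq_intros)
  have q_hol: "q holomorphic_on ball 0 1" using q unfolding holomorphic_on_open[OF open_ball] by blast
  have q_0: "q 0 = 0" by (simp add: q_def)
  have f_inj: "inj_on (\<lambda>z. z * exp (q z)) (ball 0 1)"
    by (rule starlike_imp_inj_on[OF q]) (use q'eq Re_Janowski_pos[OF AB1 pow] in auto)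
  define h where "h = (\<lambda>z. exp (- q z))"
  have h_hol: "h holomorphic_on ball 0 1" unfolding h_def by (intro holomorphic_intros q_hol)
  have h': "(h has_field_derivative - q' z * h z) (at z)" if "z \<in> ball 0 1" for z
    unfolding h_def using q[OF that] by (auto intro!: derivative_eq_intros)
  define g where "g = reflected_exp q"
  have g_h: "g = (\<lambda>z. z * h (1 / z))" by (simp add: fun_eq_iff g_def h_def reflected_exp_def)
  have g_inj: "inj_on g exterior"
    unfolding g_def by (rule reflected_exp_inj_on[OF q_hol q_0 f_inj])
  define b where "b = fps_nth (fps_expansion h 0)"
  have b: "expands_at g b z" if "z \<in> exterior" for z
    unfolding g_def b_def h_def by (rule reflected_exp_expands_at[OF q_hol q_0 f_inj that])
  have star: "star_quotient g z = (1 + of_real A * z ^ m) / (1 + of_real B * z ^ m)" if z: "z \<in> ball 0 1" for z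
  proof (cases "z = 0")
    case True then show ?thesis using m by (simp add: star_quotient_def zero_power)
  next
    case False
    have "(g has_field_derivative h z - z * (- q' z * h z)) (at (1 / z))"
      unfolding g_h by (rule has_field_derivative_reflected[OF h'[OF z] False])
    then have "deriv g (1 / z) = (1 + z * q' z) * h z" by (simp add: DERIV_imp_deriv algebra_simps)
    then have "star_quotient g z = 1 + z * q' z"
      using False by (simp add: star_quotient_def g_h h_def)
    then show ?thesis using q'eq[OF z] by simp
  qed
  have gS: "g \<in> Sigma_star A B"
    unfolding Sigma_star_def subordinate_def
  proof (intro CollectI conjI)
    show "g \<in> Sigma_class"
      unfolding g_def by (rule reflected_exp_in_Sigma_class[OF q_hol q_0 f_inj])
    have "(\<lambda>z. (1 + of_real A * z ^ m) / (1 + of_real B * z ^ m)) holomorphic_on ball (0::complex) 1"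
      by (intro holomorphic_intros) (use ne in auto)
    then show "star_quotient g holomorphic_on ball 0 1"
      by (rule holomorphic_transform) (simp add: star)
    show "(\<lambda>z. (1 + of_real A * z) / (1 + of_real B * z)) holomorphic_on ball (0::complex) 1"
      by (intro holomorphic_intros) (use one_plus_mult_ne_0[OF AB1(2)] in auto)
    show "\<exists>\<omega>. \<omega> holomorphic_on ball 0 1 \<and> \<omega> 0 = 0 \<and>
        (\<forall>z\<in>ball 0 1. \<omega> z \<in> ball 0 1 \<and>
           star_quotient g z = (1 + of_real A * \<omega> z) / (1 + of_real B * \<omega> z))"
      using m pow star by (intro exI[of _ "\<lambda>z. z ^ m"]) (auto intro!: holomorphic_intros)
  qed
  obtain G c where inv: "inverse_near_infinity g G c"
    unfolding g_def using reflected_exp_inverse[OF q_hol q_0 f_inj] by blast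
  define H where "H = infinity_fps b"
  have hH: "h has_fps_expansion H"
  proof -
    have "H = fps_expansion h 0"
      unfolding H_def b_def by (rule normalized_infinity_fps) (simp add: fps_expansion_def h_def q_0)
    moreover have "h has_fps_expansion fps_expansion h 0"
      by (rule has_fps_expansion_fps_expansion[OF _ _ h_hol]) auto
    ultimately show ?thesis by simp
  qed
  have "fps_X * fps_deriv H * (1 + fps_const (of_real B) * fps_X ^ m) = - (fps_const (of_real (A - B)) * (fps_X ^ m * H))"
  proof -
    have "z * deriv h z * (1 + of_real B * z ^ m) = - (of_real (A - B) * (z ^ m * h z))" if "z \<in> ball 0 1" for z
    proof -
      have h'z: "deriv h z = - q' z * h z" using h'[OF that] by (rule DERIV_imp_deriv)
      have q'z: "q' z * (1 + of_real B * z ^ m) = of_real (A - B) * z ^ (m - 1)"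
        using ne[OF that] by (simp add: q'_def)
      have "z * deriv h z * (1 + of_real B * z ^ m) = - (z * h z * (q' z * (1 + of_real B * z ^ m)))"
        unfolding h'z by (simp add: mult_ac)
      also have "\<dots> = - (of_real (A - B) * ((z * z ^ (m - 1)) * h z))"
        unfolding q'z by (simp only: mult_ac)
      finally have "z * deriv h z * (1 + of_real B * z ^ m) = - (of_real (A - B) * ((z * z ^ (m - 1)) * h z))" .
      then show ?thesis unfolding zm .
    qed
    then have ev: "eventually (\<lambda>z. z * deriv h z * (1 + of_real B * z ^ m) = - (of_real (A - B) * (z ^ m * h z))) (nhds 0)"
      using eventually_nhds_in_open[of "ball (0::complex) 1" 0] by (auto elim!: eventually_mono)
    have "(\<lambda>z. z * deriv h z * (1 + of_real B * z ^ m)) has_fps_expansion fps_X * fps_deriv H * (1 + fps_const (of_real B) * fps_X ^ m)"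
      by (intro fps_expansion_intros hH)
    moreover have "(\<lambda>z. - (of_real (A - B) * (z ^ m * h z))) has_fps_expansion - (fps_const (of_real (A - B)) * (fps_X ^ m * H))"
      by (intro fps_expansion_intros hH)
    ultimately show ?thesis
      using has_fps_expansion_cong[OF ev refl] fps_expansion_unique_complex by blast
  qed
  from ode_power[OF this]
  have ode: "fps_X * fps_deriv (H ^ n) = - (fps_X ^ m * (fps_const (of_nat n * of_real (A - B)) * H ^ n + fps_const (of_real B) * (fps_X * fps_deriv (H ^ n))))" for n .
  have Hn: "real m * norm (fps_nth (H ^ n) m) = real n * (A - B)" for n
  proof -
    have "of_nat m * fps_nth (H ^ n) m = - (of_nat n * of_real (A - B))"
      using arg_cong[OF ode[of n], of "\<lambda>S. fps_nth S m"]
      unfolding fps_nth_X_mult_deriv fps_neg_nth fps_X_power_mult_nth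
      by (simp add: fps_nth_power_0 H_def infinity_fps_nth)
    then have "norm (of_nat m * fps_nth (H ^ n) m) = norm (of_nat n * complex_of_real (A - B))" by simp
    then show ?thesis using AB by (simp only: norm_mult norm_of_nat norm_of_real)
  qed
  have "norm (c m) = (A - B) / real m"
  proof (cases "m = 1")
    case True
    then show ?thesis using Hn[of 1] inverse_coefficients(1)[OF b g_inj inv] by (simp add: H_def)
  next
    case False
    then obtain n where n: "m = Suc n" "0 < n" using m by (cases m) auto
    have "real n * norm (c m) = norm (fps_nth (H ^ n) m)"
      using arg_cong[OF inverse_coefficients(2)[OF b g_inj inv, of n], of norm] by (simp add: norm_mult n(1) H_def)
    then have "real n * (real m * norm (c m)) = real n * (A - B)" using Hn[of n] by (simp add: mult_ac)
    then have "real m * norm (c m) = A - B" using n(2) by simp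
    then show ?thesis using m by (simp add: field_simps)
  qed
  then show ?thesis using gS inv by blast
qed

theorem theorem3p9:
  fixes A B :: real
  assumes "-1 \<le> B" and "B < A" and "A \<le> 1"
  shows
    "(\<forall>g\<in>Sigma_star A B. \<forall>G c. inverse_near_infinity g G c \<longrightarrow>
        (norm (c 1) \<le> A - B \<and> norm (c 2) \<le> (A - B) / 2) \<and>
        (\<forall>n\<ge>2. \<forall>k\<in>{0..n - 2}. delta A B \<in> I_interval n k \<longrightarrow>
           norm (c (n + 1)) \<le> (real n - real k) / (real n * (real n + 1)) *
             (\<Prod>j = 0..n - k - 1. (real n * (A - B) + B * real j) / (real j + 1))) \<and>
        (\<forall>n\<ge>2. delta A B \<in> I_interval n (n - 1) \<longrightarrow>
           norm (c (n + 1)) \<le> (A - B) / (real n + 1))) \<and>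
     (\<exists>g\<in>Sigma_star A B. \<exists>G c. inverse_near_infinity g G c \<and> norm (c 1) = A - B) \<and>
     (\<exists>g\<in>Sigma_star A B. \<exists>G c. inverse_near_infinity g G c \<and> norm (c 2) = (A - B) / 2) \<and>
     (\<forall>n\<ge>2. delta A B \<in> I_interval n (n - 1) \<longrightarrow>
        (\<exists>g\<in>Sigma_star A B. \<exists>G c. inverse_near_infinity g G c \<and>
           norm (c (n + 1)) = (A - B) / (real n + 1)))"
proof (intro conjI ballI allI impI)
  note sharp = extremal_function[OF assms]
  show "\<exists>g\<in>Sigma_star A B. \<exists>G c. inverse_near_infinity g G c \<and> norm (c 1) = A - B"
    using sharp[of 1] by simp
  show "\<exists>g\<in>Sigma_star A B. \<exists>G c. inverse_near_infinity g G c \<and> norm (c 2) = (A - B) / 2"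
    using sharp[of 2] by simp
  show "\<exists>g\<in>Sigma_star A B. \<exists>G c. inverse_near_infinity g G c \<and> norm (c (n + 1)) = (A - B) / (real n + 1)" for n
    using sharp[of "n + 1"] by (simp add: add.commute)
  fix g G c assume g: "g \<in> Sigma_star A B" and inv: "inverse_near_infinity g G c"
  note bound = inverse_coefficient_bound[OF assms g inv]
  have "delta A B \<in> I_interval 1 0" using assms by (simp add: delta_def I_interval_def field_simps)
  from bound[OF _ _ this] show "norm (c 1) \<le> A - B" "norm (c 2) \<le> (A - B) / 2"
    by (simp_all add: numeral_2_eq_2)
  show "norm (c (n + 1)) \<le> (real n - real k) / (real n * (real n + 1)) *
      (\<Prod>j = 0..n - k - 1. (real n * (A - B) + B * real j) / (real j + 1))"
    if "2 \<le> n" "k \<in> {0..n - 2}" "delta A B \<in> I_interval n k" for n k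
    by (rule bound(1)) (use that in auto)
  show "norm (c (n + 1)) \<le> (A - B) / (real n + 1)"
    if n: "2 \<le> n" and \<delta>: "delta A B \<in> I_interval n (n - 1)" for n
  proof -
    have "norm (c (n + 1)) \<le> (real n - real (n - 1)) / (real n * (real n + 1)) *
      (\<Prod>j = 0..n - (n - 1) - 1. (real n * (A - B) + B * real j) / (real j + 1))"
      by (rule bound(1)) (use n \<delta> in auto)
    then show ?thesis using n by (simp add: of_nat_diff)
  qed
qed

end
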